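(* Let $m,n\ge 2$ and $\varphi\in\Phi_m$. Then there is a $1$-unconditional convex body $J_\varphi\subset[-1,1]^m$, containing $e_1,\dots,e_m$ in its boundary, defined by $$J_\varphi\cap[0,\infty)^m=\{(x_1,\dots,x_m)\in[0,1]^m:\varphi(x_1,\dots,x_m)\le 1\}.$$ Moreover, $+_\varphi:\left(\mathcal{K}^n_s\right)^m\to\mathcal{K}^n_s$ is $M$-addition $\oplus_M$ with $M=J_\varphi^\circ$, that is, $+_\varphi(K_1,\dots,K_m)=\oplus_{J_\varphi^\circ}(K_1,\dots,K_m)$ for all $K_1,\dots,K_m\in\mathcal{K}^n_s$; and $+_\varphi:\left(\mathcal{K}^n_o\right)^m\to\mathcal{K}^n_o$ is $M$-addition $\oplus_M$ with $M=J_\varphi^\circ\cap[0,\infty)^m$, that is, $+_\varphi(K_1,\dots,K_m)=\oplus_{J_\varphi^\circ\cap[0,\infty)^m}(K_1,\dots,K_m)$ for all $K_1,\dots,K_m\in\mathcal{K}^n_o$. Furthermore, $$h_{+_\varphi(K_1,\dots,K_m)}(x)=h_{J_\varphi^\circ}\left(h_{K_1}(x),\dots,h_{K_m}(x)\right)$$ for all $K_1,\dots,K_m\in\mathcal{K}^n_o$ and $x\in\mathbb{R}^n$.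
   Context: $\mathcal{K}^n_o$ is the class of compact convex subsets of $\mathbb{R}^n$ containing the origin $o$; $\mathcal{K}^n_s$ is the class of nonempty compact convex sets $K$ in $\mathbb{R}^n$ with $K=-K$. A convex body is a compact convex set with nonempty interior. A set in $\mathbb{R}^m$ is $1$-unconditional if it is symmetric with respect to each coordinate hyperplane. The support function of $K$ is $h_K(x)=\sup\{x\cdot y:y\in K\}$, and the polar set is $K^\circ=\{x:x\cdot y\le 1\text{ for all }y\in K\}$. $\Phi_m$ is the set of convex functions $\varphi:[0,\infty)^m\to[0,\infty)$ that are increasing (i.e. nondecreasing) in each variable and satisfy $\varphi(o)=0$ and $\varphi(e_j)=1$, $j=1,\dots,m$, where $e_1,\dots,e_m$ is the standard basis. For $\varphi\in\Phi_m$ and $K_1,\dots,K_m\in\mathcal{K}^n_o$, the Orlicz sum $+_\varphi(K_1,\dots,K_m)$ is the compact convex set with support function $$h_{+_\varphi(K_1,\dots,K_m)}(x)=\inf\left\{\lambda>0:\varphi\left(\frac{h_{K_1}(x)}{\lambda},\dots,\frac{h_{K_m}(x)}{\lambda}\right)\le 1\right\},\quad x\in\mathbb{R}^n.$$ For $M\subset\mathbb{R}^m$ and sets $K_1,\dots,K_m\subset\mathbb{R}^n$, the $M$-sum is $\oplus_M(K_1,\dots,K_m)=\left\{\sum_{j=1}^m a_jx^{(j)}:x^{(j)}\in K_j,\ (a_1,\dots,a_m)\in M\right\}$. *)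

theory Defs
  imports "HOL-Analysis.Analysis"
begin

definition compact_convex_o :: "('a::euclidean_space) set set" where
  "compact_convex_o = {K. compact K \<and> convex K \<and> 0 \<in> K}"

definition compact_convex_s :: "('a::euclidean_space) set set" where
  "compact_convex_s = {K. K \<noteq> {} \<and> compact K \<and> convex K \<and> K = uminus ` K}"

definition convex_body :: "('a::euclidean_space) set \<Rightarrow> bool" where
  "convex_body K \<longleftrightarrow> compact K \<and> convex K \<and> interior K \<noteq> {}"

definition coord_reflect :: "'m \<Rightarrow> real ^ 'm \<Rightarrow> real ^ 'm" where
  "coord_reflect j x = (\<chi> i. if i = j then - (x $ i) else x $ i)"

definition unconditional :: "(real ^ 'm) set \<Rightarrow> bool" where
  "unconditional A \<longleftrightarrow> (\<forall>j. coord_reflect j ` A = A)"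

text \<open>The supremum is a real one, so the value is meaningful for nonempty bounded \<open>K\<close> only.\<close>

definition support_fun :: "('a::euclidean_space) set \<Rightarrow> 'a \<Rightarrow> real" where
  "support_fun K x = (SUP y\<in>K. x \<bullet> y)"

definition polar_set :: "('a::euclidean_space) set \<Rightarrow> 'a set" where
  "polar_set K = {x. \<forall>y\<in>K. x \<bullet> y \<le> 1}"

definition nonneg_orthant :: "(real ^ 'm) set" where
  "nonneg_orthant = {x. \<forall>i. 0 \<le> x $ i}"

text \<open>
  A function on \<open>[0,\<infinity>)\<^sup>m\<close> is represented by a total function, whose values outside the
  nonnegative orthant are unconstrained and are never used.
\<close>

definition Phi :: "(real ^ 'm \<Rightarrow> real) set" where
  "Phi = {\<phi>. convex_on nonneg_orthant \<phi>
            \<and> (\<forall>x\<in>nonneg_orthant. 0 \<le> \<phi> x)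
            \<and> (\<forall>x\<in>nonneg_orthant. \<forall>j.
                 mono_on {0..} (\<lambda>t. \<phi> (\<chi> i. if i = j then t else x $ i)))
            \<and> \<phi> 0 = 0
            \<and> (\<forall>j. \<phi> (axis j 1) = 1)}"

definition orlicz_support ::
  "(real ^ 'm \<Rightarrow> real) \<Rightarrow> ('m \<Rightarrow> ('a::euclidean_space) set) \<Rightarrow> 'a \<Rightarrow> real" where
  "orlicz_support \<phi> K x = Inf {l. l > 0 \<and> \<phi> (\<chi> j. support_fun (K j) x / l) \<le> 1}"

text \<open>
  Nonempty compact convex sets are determined by their support functions, so at most one set
  fits the description.
\<close>

definition orlicz_sum ::
  "(real ^ 'm \<Rightarrow> real) \<Rightarrow> ('m \<Rightarrow> ('a::euclidean_space) set) \<Rightarrow> 'a set" where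
  "orlicz_sum \<phi> K =
     (THE L. L \<noteq> {} \<and> compact L \<and> convex L \<and> (\<forall>x. support_fun L x = orlicz_support \<phi> K x))"

definition M_sum ::
  "(real ^ 'm) set \<Rightarrow> ('m \<Rightarrow> ('a::euclidean_space) set) \<Rightarrow> 'a set" where
  "M_sum M K = {(\<Sum>j\<in>UNIV. (a $ j) *\<^sub>R x j) | a x. a \<in> M \<and> (\<forall>j. x j \<in> K j)}"

end

theory Submission
  imports Defs
begin

text \<open>
  The body is \<open>J = {x. \<phi> \<bar>x\<bar> \<le> 1}\<close>, where \<open>\<bar>x\<bar>\<close> is taken coordinatewise; it is closed because
  \<open>\<phi>\<close> is monotone and continuous along rays.
  By separation, the support function of the polar of \<open>J\<close> is the gauge of \<open>J\<close>, and the
  gauge of \<open>J\<close> at \<open>(h\<^sub>K\<^sub>1(x), \<dots>, h\<^sub>K\<^sub>m(x))\<close> is precisely the Orlicz expression.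
  If \<open>M\<close> lies in the nonnegative orthant, then \<open>\<oplus>\<^sub>M(K\<^sub>1, \<dots>, K\<^sub>m)\<close> is compact and convex with
  support function \<open>h\<^sub>M(h\<^sub>K\<^sub>1(x), \<dots>, h\<^sub>K\<^sub>m(x))\<close>, and a compact convex set is determined by
  its support function. For symmetric \<open>K\<^sub>j\<close> the signs of the coefficients can be absorbed into
  the points, so that the whole polar body may replace its part in the orthant.
\<close>

subsection \<open>Support functions\<close>

lemma support_fun_attained:
  assumes "compact K" "K \<noteq> {}"
  obtains y where "y \<in> K" "support_fun K x = x \<bullet> y" "\<And>z. z \<in> K \<Longrightarrow> x \<bullet> z \<le> x \<bullet> y"
proof -
  have "continuous_on K (\<lambda>y. x \<bullet> y)"
    by (intro continuous_intros)
  then obtain y where y: "y \<in> K" "\<And>z. z \<in> K \<Longrightarrow> x \<bullet> z \<le> x \<bullet> y"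
    using continuous_attains_sup[OF assms] by blast
  then have "support_fun K x = x \<bullet> y"
    unfolding support_fun_def by (intro cSup_eq_maximum) auto
  with y that show thesis
    by blast
qed

lemma inner_le_support_fun:
  assumes "compact K" "y \<in> K"
  shows "x \<bullet> y \<le> support_fun K x"
  using assms by (metis empty_iff support_fun_attained)

text \<open>A point of \<open>K\<close> outside \<open>L\<close> would be strictly separated from
  \<open>L\<close> by a hyperplane, and in the direction normal to it the support function of
  \<open>K\<close> would exceed that of \<open>L\<close>.\<close>

lemma support_fun_subset_imp_subset:
  assumes L: "compact L" "convex L" "L \<noteq> {}" and K: "compact K"
    and le: "\<And>x. support_fun K x \<le> support_fun L x"
  shows "K \<subseteq> L"
proof
  fix z assume z: "z \<in> K"
  show "z \<in> L"
  proof (rule ccontr)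
    assume "z \<notin> L"
    then obtain a b where ab: "a \<bullet> z < b" "\<And>x. x \<in> L \<Longrightarrow> a \<bullet> x > b"
      using separating_hyperplane_closed_point[of L z] L compact_imp_closed by blast
    obtain y where y: "y \<in> L" "support_fun L (- a) = (- a) \<bullet> y"
      using support_fun_attained[of L "- a"] L by metis
    \<comment> \<open>The separation puts \<open>L\<close> on the upper side of the hyperplane, so
      the direction to test is \<open>- a\<close>.\<close>
    have "(- a) \<bullet> z \<le> (- a) \<bullet> y"
      using inner_le_support_fun[OF K z, of "- a"] le[of "- a"] y by linarith
    with ab(1) ab(2)[OF y(1)] show False
      by simp
  qed
qed

lemma support_fun_inject:
  assumes "compact L" "convex L" "L \<noteq> {}" "compact K" "convex K" "K \<noteq> {}"
    and "\<And>x. support_fun K x = support_fun L x"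
  shows "K = L"
  using assms support_fun_subset_imp_subset[of L K] support_fun_subset_imp_subset[of K L]
  by (intro subset_antisym) auto

text \<open>Discharges the definite description: existence is the given \<open>L\<close>, uniqueness
  is \<open>support_fun_inject\<close>.\<close>

lemma orlicz_sum_eqI:
  assumes "L \<noteq> {}" "compact L" "convex L" "\<And>x. support_fun L x = orlicz_support \<phi> K x"
  shows "orlicz_sum \<phi> K = L"
  unfolding orlicz_sum_def
proof (rule the_equality)
  fix L'
  assume "L' \<noteq> {} \<and> compact L' \<and> convex L' \<and> (\<forall>x. support_fun L' x = orlicz_support \<phi> K x)"
  with assms show "L' = L"
    by (intro support_fun_inject) auto
qed (use assms in auto)

lemma support_fun_nonneg:
  assumes "K \<in> compact_convex_o"
  shows "0 \<le> support_fun K x"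
  using assms inner_le_support_fun[of K 0 x] by (auto simp: compact_convex_o_def)

lemma compact_convex_s_subset_o: "compact_convex_s \<subseteq> compact_convex_o"
proof
  fix K :: "'a set" assume K: "K \<in> compact_convex_s"
  then obtain x where x: "x \<in> K" "- x \<in> K"
    by (auto simp: compact_convex_s_def)
  have "(1/2) *\<^sub>R x + (1/2) *\<^sub>R (- x) \<in> K"
    using K x by (intro convexD) (auto simp: compact_convex_s_def)
  then show "K \<in> compact_convex_o"
    using K by (simp add: compact_convex_s_def compact_convex_o_def)
qed


subsection \<open>Polar sets\<close>

lemma closed_polar_set: "closed (polar_set K)"
proof -
  have "polar_set K = (\<Inter>y\<in>K. {x. y \<bullet> x \<le> 1})"
    by (auto simp: polar_set_def inner_commute)
  then show ?thesis
    by (auto intro!: closed_INT closed_halfspace_le)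
qed

lemma convex_polar_set: "convex (polar_set K)"
proof -
  have "polar_set K = (\<Inter>y\<in>K. {x. y \<bullet> x \<le> 1})"
    by (auto simp: polar_set_def inner_commute)
  then show ?thesis
    by (auto intro!: convex_INT convex_halfspace_le)
qed

lemma zero_mem_polar_set: "0 \<in> polar_set K"
  by (simp add: polar_set_def)

text \<open>Polarity reverses inclusion: a ball of radius \<open>r\<close> inside \<open>J\<close>
  confines the polar set to the ball of radius \<open>1 / r\<close>.\<close>

lemma compact_polar_set:
  assumes "0 \<in> interior J"
  shows "compact (polar_set J)"
proof -
  obtain r where r: "r > 0" "cball 0 r \<subseteq> J"
    using assms by (auto simp: mem_interior_cball)
  have "norm y \<le> 1 / r" if y: "y \<in> polar_set J" for y
  proof (cases "y = 0")
    case False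
    \<comment> \<open>The point of the ball farthest in direction \<open>y\<close>; its inner
      product with \<open>y\<close> is \<open>r * norm y\<close>.\<close>
    have "(r / norm y) *\<^sub>R y \<in> J"
      using r False by (intro subsetD[OF r(2)]) auto
    then have "y \<bullet> ((r / norm y) *\<^sub>R y) \<le> 1"
      using y unfolding polar_set_def by blast
    then have "r * norm y \<le> 1"
      using False by (simp add: dot_square_norm power2_eq_square)
    with r show ?thesis
      by (simp add: field_simps)
  qed (use r in auto)
  then show ?thesis
    by (simp add: compact_eq_bounded_closed closed_polar_set) (auto simp: bounded_iff)
qed

text \<open>The right-hand side is the gauge of \<open>J\<close>. Every admissible \<open>l\<close>
  is at least \<open>?s\<close> by the definition of the polar set, and every \<open>l\<close> above
  \<open>?s\<close> is admissible by separation.\<close>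

lemma support_fun_polar_set:
  assumes J: "closed J" "convex J" "0 \<in> interior J"
  shows "support_fun (polar_set J) h = Inf {l. l > 0 \<and> (1 / l) *\<^sub>R h \<in> J}"
    (is "?s = Inf ?A")
proof -
  have cP: "compact (polar_set J)" and nP: "polar_set J \<noteq> {}"
    using compact_polar_set[OF J(3)] zero_mem_polar_set[of J] by auto
  have s0: "0 \<le> ?s"
    using inner_le_support_fun[OF cP zero_mem_polar_set, of h] by simp
  have J0: "0 \<in> J"
    using J(3) interior_subset by blast
  have lower: "?s \<le> l" if l: "l \<in> ?A" for l
  proof -
    obtain y where y: "y \<in> polar_set J" "?s = h \<bullet> y"
      using support_fun_attained[OF cP nP, of h] by metis
    have "y \<bullet> ((1 / l) *\<^sub>R h) \<le> 1"
      using y(1) l unfolding polar_set_def by blast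
    with l y show ?thesis
      by (simp add: field_simps inner_commute)
  qed
  have upper: "l \<in> ?A" if l: "?s < l" for l
  proof (rule ccontr)
    assume "l \<notin> ?A"
    moreover have lpos: "l > 0"
      using s0 l by simp
    ultimately have "(1 / l) *\<^sub>R h \<notin> J"
      by simp
    then obtain a b where ab: "a \<bullet> ((1 / l) *\<^sub>R h) < b" "\<And>x. x \<in> J \<Longrightarrow> a \<bullet> x > b"
      using separating_hyperplane_closed_point[OF J(2,1)] by blast
    have b: "b < 0"
      using ab(2)[OF J0] by simp
    \<comment> \<open>Dividing by the negative \<open>b\<close> turns the lower bound
      \<open>b\<close> on \<open>J\<close> into the upper bound \<open>1\<close>. The resulting
      polar point pairs with \<open>h\<close> to more than \<open>l\<close>, against
      \<open>?s < l\<close>.\<close>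
    have "(1 / b) *\<^sub>R a \<in> polar_set J"
      using ab(2) b by (fastforce simp: polar_set_def divide_simps)
    from inner_le_support_fun[OF cP this, of h] have "(h \<bullet> a) / b \<le> ?s"
      by simp
    moreover have "(h \<bullet> a) / b > l"
      using ab(1) b lpos by (simp add: field_simps inner_commute)
    ultimately show False
      using l by simp
  qed
  have ne: "?A \<noteq> {}"
    using upper[of "?s + 1"] by auto
  show ?thesis
  proof (rule antisym)
    show "?s \<le> Inf ?A"
      using ne lower by (rule cInf_greatest)
    show "Inf ?A \<le> ?s"
    \<comment> \<open>The infimum need not be attained: for \<open>h = 0\<close> it is
      \<open>0\<close>, which is not admissible. Hence the comparison with every \<open>l\<close>
      above \<open>?s\<close>.\<close>
    proof (rule dense_ge)
      fix l assume "?s < l"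
      then show "Inf ?A \<le> l"
        using upper lower by (intro cInf_lower bdd_belowI[of _ ?s]) blast+
    qed
  qed
qed


subsection \<open>Unconditional sets\<close>

lemma abs_vec_component [simp]: "\<bar>x :: real ^ 'm\<bar> $ i = \<bar>x $ i\<bar>"
  by (simp add: abs_vec_def)

lemma abs_vec_idem: "\<bar>\<bar>x :: real ^ 'm\<bar>\<bar> = \<bar>x\<bar>"
  by (simp add: vec_eq_iff)

lemma abs_vec_mem_nonneg_orthant [simp]: "\<bar>x :: real ^ 'm\<bar> \<in> nonneg_orthant"
  by (simp add: nonneg_orthant_def)

lemma abs_vec_of_nonneg: "x \<in> nonneg_orthant \<Longrightarrow> \<bar>x :: real ^ 'm\<bar> = x"
  by (simp add: nonneg_orthant_def vec_eq_iff)

lemma coord_reflect_coord_reflect [simp]: "coord_reflect j (coord_reflect j x) = x"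
  by (simp add: coord_reflect_def vec_eq_iff)

lemma abs_coord_reflect [simp]: "\<bar>coord_reflect j x\<bar> = \<bar>x\<bar>"
  by (simp add: coord_reflect_def vec_eq_iff)

lemma inner_coord_reflect: "coord_reflect j x \<bullet> y = x \<bullet> coord_reflect j y"
  by (auto simp: inner_vec_def coord_reflect_def intro!: sum.cong)

lemma unconditionalI:
  assumes "\<And>j x. x \<in> A \<Longrightarrow> coord_reflect j x \<in> A"
  shows "unconditional A"
  unfolding unconditional_def
proof (intro allI subset_antisym subsetI)
  fix j x assume "x \<in> A"
  then show "x \<in> coord_reflect j ` A"
    using assms by (intro image_eqI[of _ _ "coord_reflect j x"]) auto
qed (use assms in auto)

lemma unconditional_coord_reflect:
  "unconditional A \<Longrightarrow> x \<in> A \<Longrightarrow> coord_reflect j x \<in> A"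
  unfolding unconditional_def by blast

text \<open>Reflecting \<open>x\<close> in the coordinates where its sign differs from that of
  \<open>y\<close> produces \<open>y\<close>. The induction runs over the set \<open>S\<close> of
  coordinates already adjusted.\<close>

lemma unconditional_abs_eq:
  assumes A: "unconditional A" and x: "x \<in> A" and eq: "\<bar>x\<bar> = \<bar>y\<bar>"
  shows "y \<in> A"
proof -
  have "(\<chi> i. if i \<in> S then y $ i else x $ i) \<in> A" for S
    using finite[of S]
  proof induction
    case empty
    then show ?case
      using x by simp
  next
    case (insert j S)
    let ?z = "\<chi> i. if i \<in> S then y $ i else x $ i"
    have "\<bar>x $ j\<bar> = \<bar>y $ j\<bar>"
      using eq by (metis abs_vec_component)
    then consider "y $ j = x $ j" | "y $ j = - (x $ j)"
      by (auto simp: abs_if split: if_splits)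
    then show ?case
    proof cases
      case 1
      then have "(\<chi> i. if i \<in> insert j S then y $ i else x $ i) = ?z"
        by (simp add: vec_eq_iff)
      with insert.IH show ?thesis
        by simp
    next
      case 2
      then have "(\<chi> i. if i \<in> insert j S then y $ i else x $ i) = coord_reflect j ?z"
        using insert.hyps by (simp add: vec_eq_iff coord_reflect_def)
      with unconditional_coord_reflect[OF A insert.IH] show ?thesis
        by simp
    qed
  qed
  from this[of UNIV] show ?thesis
    by simp
qed

lemma unconditional_abs_iff:
  assumes "unconditional A"
  shows "\<bar>x\<bar> \<in> A \<longleftrightarrow> x \<in> A"
  using unconditional_abs_eq[OF assms] by (metis abs_vec_idem)

text \<open>This is what makes the prescribed part in the orthant a definition of the body.\<close>

lemma unconditional_eqI:
  assumes "unconditional A" "unconditional B"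
    and "A \<inter> nonneg_orthant = B \<inter> nonneg_orthant"
  shows "A = B"
proof (intro set_eqI)
  fix x
  have "\<bar>x\<bar> \<in> A \<longleftrightarrow> \<bar>x\<bar> \<in> B"
    using assms(3) abs_vec_mem_nonneg_orthant[of x] by blast
  then show "x \<in> A \<longleftrightarrow> x \<in> B"
    using assms(1,2) by (simp add: unconditional_abs_iff)
qed

lemma unconditional_polar_set:
  assumes "unconditional A"
  shows "unconditional (polar_set A)"
  by (intro unconditionalI)
    (auto simp: polar_set_def inner_coord_reflect unconditional_coord_reflect[OF assms])

text \<open>Against a nonnegative \<open>v\<close>, replacing a maximiser \<open>a\<close> by
  \<open>\<bar>a\<bar>\<close> does not decrease the inner product, so some maximiser lies in the
  orthant.\<close>

lemma support_fun_unconditional: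
  assumes P: "unconditional P" "compact P" "P \<noteq> {}" and v: "v \<in> nonneg_orthant"
  shows "support_fun (P \<inter> nonneg_orthant) v = support_fun P v"
proof -
  obtain a where a: "a \<in> P" "support_fun P v = v \<bullet> a" "\<And>z. z \<in> P \<Longrightarrow> v \<bullet> z \<le> v \<bullet> a"
    using support_fun_attained[OF P(2,3), of v] by metis
  have aP: "\<bar>a\<bar> \<in> P"
    using a(1) P(1) by (simp add: unconditional_abs_iff)
  have "v \<bullet> a \<le> v \<bullet> \<bar>a\<bar>"
    using v unfolding inner_vec_def nonneg_orthant_def
    by (auto intro!: sum_mono mult_left_mono)
  with a(3)[OF aP] have "v \<bullet> \<bar>a\<bar> = v \<bullet> a"
    by simp
  with a aP show ?thesis
    unfolding a(2) unfolding support_fun_def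
    by (intro cSup_eq_maximum) (auto intro!: image_eqI[of _ _ "\<bar>a\<bar>"])
qed


subsection \<open>\<open>M\<close>-sums\<close>

lemma M_sumI:
  assumes "a \<in> M" "\<And>j. x j \<in> K j"
  shows "(\<Sum>j\<in>UNIV. (a $ j) *\<^sub>R x j) \<in> M_sum M K"
  unfolding M_sum_def using assms by auto

lemma M_sumE:
  assumes "z \<in> M_sum M K"
  obtains a x where "z = (\<Sum>j\<in>UNIV. (a $ j) *\<^sub>R x j)" "a \<in> M" "\<And>j. x j \<in> K j"
  using assms unfolding M_sum_def by blast

text \<open>The product of the \<open>K j\<close> is realised inside a Euclidean space, where closed
  and bounded suffices; \<open>M_sum\<close> then becomes a continuous image of a compact
  set.\<close>

lemma compact_vec_box:
  fixes K :: "'m::finite \<Rightarrow> 'a::euclidean_space set"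
  assumes "\<And>j. compact (K j)"
  shows "compact {x :: 'a ^ 'm. \<forall>j. x $ j \<in> K j}"
proof -
  have "\<forall>j. \<exists>B. \<forall>x\<in>K j. norm x \<le> B"
    using assms compact_imp_bounded bounded_iff by metis
  then obtain B where B: "\<And>j x. x \<in> K j \<Longrightarrow> norm x \<le> B j"
    by metis
  have "norm x \<le> (\<Sum>j\<in>UNIV. B j)" if "\<forall>j. x $ j \<in> K j" for x :: "'a ^ 'm"
  proof -
    have "norm x \<le> (\<Sum>j\<in>UNIV. norm (x $ j))"
      unfolding norm_vec_def by (rule L2_set_le_sum) simp
    also have "\<dots> \<le> (\<Sum>j\<in>UNIV. B j)"
      using that B by (intro sum_mono) auto
    finally show ?thesis .
  qed
  then have "bounded {x :: 'a ^ 'm. \<forall>j. x $ j \<in> K j}"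
    by (auto simp: bounded_iff)
  then show ?thesis
    using assms by (simp add: compact_eq_bounded_closed closed_vector_box)
qed

lemma compact_M_sum:
  fixes K :: "'m::finite \<Rightarrow> 'a::euclidean_space set"
  assumes "compact M" "\<And>j. compact (K j)"
  shows "compact (M_sum M K)"
proof -
  let ?B = "{x :: 'a ^ 'm. \<forall>j. x $ j \<in> K j}"
  let ?f = "\<lambda>(a :: real ^ 'm, x :: 'a ^ 'm). \<Sum>j\<in>UNIV. (a $ j) *\<^sub>R (x $ j)"
  have "compact (?f ` (M \<times> ?B))"
    unfolding case_prod_beta
    by (intro compact_continuous_image continuous_intros compact_Times assms compact_vec_box)
  moreover have "M_sum M K = ?f ` (M \<times> ?B)"
  proof (intro set_eqI iffI)
    fix z assume "z \<in> M_sum M K"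
    then obtain a x where "z = (\<Sum>j\<in>UNIV. (a $ j) *\<^sub>R x j)" "a \<in> M" "\<And>j. x j \<in> K j"
      by (blast elim: M_sumE)
    then show "z \<in> ?f ` (M \<times> ?B)"
      by (intro image_eqI[of _ _ "(a, \<chi> j. x j)"]) auto
  qed (force simp: M_sum_def)
  ultimately show ?thesis
    by simp
qed

text \<open>In each coordinate the combination of \<open>(a $ j) *\<^sub>R x j\<close> and
  \<open>(b $ j) *\<^sub>R y j\<close> is \<open>c $ j\<close> times a weighted mean of
  \<open>x j\<close> and \<open>y j\<close>. The weights are nonnegative because \<open>M\<close>
  lies in the orthant.\<close>

lemma convex_M_sum:
  assumes M: "convex M" "M \<subseteq> nonneg_orthant" and K: "\<And>j. convex (K j)"
  shows "convex (M_sum M K)"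
proof (rule convexI)
  fix z w and u v :: real
  assume "z \<in> M_sum M K" "w \<in> M_sum M K" and uv: "0 \<le> u" "0 \<le> v" "u + v = 1"
  then obtain a b x y where z: "z = (\<Sum>j\<in>UNIV. (a $ j) *\<^sub>R x j)" "a \<in> M" "\<And>j. x j \<in> K j"
    and w: "w = (\<Sum>j\<in>UNIV. (b $ j) *\<^sub>R y j)" "b \<in> M" "\<And>j. y j \<in> K j"
    unfolding M_sum_def by blast
  define c where "c = u *\<^sub>R a + v *\<^sub>R b"
  have c: "c \<in> M"
    unfolding c_def using M(1) z(2) w(2) uv by (rule convexD)
  have "\<exists>p\<in>K j. u *\<^sub>R (a $ j) *\<^sub>R x j + v *\<^sub>R (b $ j) *\<^sub>R y j = (c $ j) *\<^sub>R p" for j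
  proof -
    have nn: "0 \<le> u * a $ j" "0 \<le> v * b $ j"
      using M(2) z(2) w(2) uv by (auto simp: nonneg_orthant_def)
    have cj: "c $ j = u * a $ j + v * b $ j"
      by (simp add: c_def)
    show ?thesis
    proof (cases "c $ j = 0")
      \<comment> \<open>Both nonnegative weights vanish, so any point of \<open>K j\<close>
        serves.\<close>
      case True
      then have "u * a $ j = 0" "v * b $ j = 0"
        using nn cj by linarith+
      then show ?thesis
        using z(3) True by (intro bexI[of _ "x j"]) auto
    next
      case False
      let ?p = "(u * a $ j / c $ j) *\<^sub>R x j + (v * b $ j / c $ j) *\<^sub>R y j"
      have "?p \<in> K j"
        using nn False cj z(3) w(3)
        by (intro convexD[OF K]) (auto simp: add_divide_distrib[symmetric])
      then show ?thesis
        using False by (intro bexI[of _ ?p]) (auto simp: scaleR_add_right)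
    qed
  qed
  then obtain p where p: "\<And>j. p j \<in> K j"
    "\<And>j. u *\<^sub>R (a $ j) *\<^sub>R x j + v *\<^sub>R (b $ j) *\<^sub>R y j = (c $ j) *\<^sub>R p j"
    by metis
  have "u *\<^sub>R z + v *\<^sub>R w = (\<Sum>j\<in>UNIV. (c $ j) *\<^sub>R p j)"
    by (simp only: z(1) w(1) scaleR_sum_right p(2)[symmetric] sum.distrib)
  with c p(1) show "u *\<^sub>R z + v *\<^sub>R w \<in> M_sum M K"
    by (simp only: M_sumI)
qed

text \<open>With nonnegative coefficients the maximisation decouples: the best \<open>x j\<close>
  maximises \<open>u\<close> over \<open>K j\<close> whatever \<open>a\<close> is, and only a
  maximisation over \<open>M\<close> is left.\<close>

lemma support_fun_M_sum:
  assumes M: "compact M" "M \<noteq> {}" "M \<subseteq> nonneg_orthant"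
    and K: "\<And>j. compact (K j)" "\<And>j. K j \<noteq> {}"
  shows "support_fun (M_sum M K) u = support_fun M (\<chi> j. support_fun (K j) u)"
proof -
  let ?h = "\<chi> j. support_fun (K j) u"
  have "\<forall>j. \<exists>y. y \<in> K j \<and> support_fun (K j) u = u \<bullet> y"
    using support_fun_attained[OF K] by metis
  then obtain y where y: "\<And>j. y j \<in> K j" "\<And>j. support_fun (K j) u = u \<bullet> y j"
    by metis
  obtain a where a: "a \<in> M" "support_fun M ?h = ?h \<bullet> a"
    using support_fun_attained[OF M(1,2)] by metis
  have "?h \<bullet> a = u \<bullet> (\<Sum>j\<in>UNIV. (a $ j) *\<^sub>R y j)"
    by (simp add: inner_sum_right inner_vec_def y(2) mult.commute)
  moreover have "(\<Sum>j\<in>UNIV. (a $ j) *\<^sub>R y j) \<in> M_sum M K"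
    using a(1) y(1) by (rule M_sumI)
  moreover have "u \<bullet> z \<le> ?h \<bullet> a" if "z \<in> M_sum M K" for z
  proof -
    obtain b x where z: "z = (\<Sum>j\<in>UNIV. (b $ j) *\<^sub>R x j)" "b \<in> M" "\<And>j. x j \<in> K j"
      using \<open>z \<in> M_sum M K\<close> by (blast elim: M_sumE)
    have "u \<bullet> z = (\<Sum>j\<in>UNIV. b $ j * (u \<bullet> x j))"
      by (simp add: z(1) inner_sum_right)
    also have "\<dots> \<le> (\<Sum>j\<in>UNIV. b $ j * support_fun (K j) u)"
      using M(3) z(2,3) K(1)
      by (intro sum_mono mult_left_mono inner_le_support_fun) (auto simp: nonneg_orthant_def)
    also have "\<dots> = ?h \<bullet> b"
      by (simp add: inner_vec_def mult.commute)
    also have "\<dots> \<le> ?h \<bullet> a"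
      using inner_le_support_fun[OF M(1) z(2), of ?h] a(2) by simp
    finally show ?thesis .
  qed
  ultimately show ?thesis
    unfolding a(2) unfolding support_fun_def
    by (intro cSup_eq_maximum) auto
qed

lemma M_sum_unconditional:
  assumes M: "unconditional M" and K: "\<And>j. K j \<in> compact_convex_s"
  shows "M_sum M K = M_sum (M \<inter> nonneg_orthant) K"
proof
  show "M_sum M K \<subseteq> M_sum (M \<inter> nonneg_orthant) K"
  proof
    fix z assume "z \<in> M_sum M K"
    then obtain a x where z: "z = (\<Sum>j\<in>UNIV. (a $ j) *\<^sub>R x j)" "a \<in> M" "\<And>j. x j \<in> K j"
      by (blast elim: M_sumE)
    define y where "y j = (if a $ j < 0 then - x j else x j)" for j
    have "z = (\<Sum>j\<in>UNIV. (\<bar>a\<bar> $ j) *\<^sub>R y j)"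
      unfolding z(1) by (intro sum.cong) (auto simp: y_def)
    moreover have "\<bar>a\<bar> \<in> M \<inter> nonneg_orthant"
      using M z(2) by (simp add: unconditional_abs_iff)
    moreover have "y j \<in> K j" for j
    proof -
      have "K j = uminus ` K j"
        using K[of j] by (simp add: compact_convex_s_def)
      then have "- x j \<in> K j"
        using z(3)[of j] by blast
      then show ?thesis
        using z(3) by (simp add: y_def)
    qed
    ultimately show "z \<in> M_sum (M \<inter> nonneg_orthant) K"
      by (simp only: M_sumI)
  qed
qed (auto simp: M_sum_def)

lemma M_sum_symmetric:
  assumes "\<And>j. K j = uminus ` K j"
  shows "M_sum M K = uminus ` M_sum M K"
proof -
  have *: "- z \<in> M_sum M K" if "z \<in> M_sum M K" for z
  proof -
    obtain a x where z: "z = (\<Sum>j\<in>UNIV. (a $ j) *\<^sub>R x j)" "a \<in> M" "\<And>j. x j \<in> K j"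
      using \<open>z \<in> M_sum M K\<close> by (blast elim: M_sumE)
    have "- z = (\<Sum>j\<in>UNIV. (a $ j) *\<^sub>R (- x j))"
      by (simp add: z(1) sum_negf)
    moreover have "- x j \<in> K j" for j
      using assms[of j] z(3)[of j] by blast
    ultimately show ?thesis
      using z(2) by (simp only: M_sumI)
  qed
  then show ?thesis
    by (force simp: image_iff)
qed


subsection \<open>The body of an Orlicz function\<close>

text \<open>No bound on the coordinates is imposed; \<open>component_le_1\<close> derives it from
  the sublevel condition.\<close>

definition Phi_body :: "(real ^ 'm \<Rightarrow> real) \<Rightarrow> (real ^ 'm) set" where
  "Phi_body \<phi> = {x. \<phi> \<bar>x\<bar> \<le> 1}"

context
  fixes \<phi> :: "real ^ 'm \<Rightarrow> real"
  assumes Phi: "\<phi> \<in> Phi"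
begin

lemma Phi_convex:
  assumes "x \<in> nonneg_orthant" "y \<in> nonneg_orthant" "0 \<le> u" "0 \<le> v" "u + v = 1"
  shows "\<phi> (u *\<^sub>R x + v *\<^sub>R y) \<le> u * \<phi> x + v * \<phi> y"
  using Phi assms by (auto simp: Phi_def convex_on_def)

lemma Phi_nonneg: "x \<in> nonneg_orthant \<Longrightarrow> 0 \<le> \<phi> x"
  using Phi by (auto simp: Phi_def)

lemma Phi_zero: "\<phi> 0 = 0"
  using Phi by (auto simp: Phi_def)

lemma Phi_axis: "\<phi> (axis j 1) = 1"
  using Phi by (auto simp: Phi_def)

text \<open>Monotonicity in each variable is applied to one coordinate at a time, \<open>S\<close>
  being the set of coordinates already raised to those of \<open>y\<close>.\<close>

lemma Phi_mono:
  assumes x: "x \<in> nonneg_orthant" and xy: "x \<le> y"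
  shows "\<phi> x \<le> \<phi> y"
proof -
  let ?z = "\<lambda>S. \<chi> i. if i \<in> S then y $ i else x $ i"
  have le: "0 \<le> x $ i" "x $ i \<le> y $ i" for i
    using x xy by (auto simp: nonneg_orthant_def less_eq_vec_def)
  then have nn: "0 \<le> y $ i" for i
    using order_trans by blast
  have "\<phi> x \<le> \<phi> (?z S)" for S
    using finite[of S]
  proof induction
    case empty
    then show ?case
      by simp
  next
    case (insert j S)
    have "?z S \<in> nonneg_orthant"
      using le(1) nn by (simp add: nonneg_orthant_def)
    then have "mono_on {0..} (\<lambda>t. \<phi> (\<chi> i. if i = j then t else ?z S $ i))"
      using Phi unfolding Phi_def by blast
    from mono_onD[OF this, of "x $ j" "y $ j"]
    have "\<phi> (\<chi> i. if i = j then x $ j else ?z S $ i) \<le> \<phi> (\<chi> i. if i = j then y $ j else ?z S $ i)"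
      using le nn by simp
    moreover have "(\<chi> i. if i = j then x $ j else ?z S $ i) = ?z S"
      using insert.hyps by (simp add: vec_eq_iff)
    moreover have "(\<chi> i. if i = j then y $ j else ?z S $ i) = ?z (insert j S)"
      by (simp add: vec_eq_iff)
    ultimately show ?case
      using insert.IH by simp
  qed
  from this[of UNIV] show ?thesis
    by simp
qed

text \<open>Convexity with the values \<open>0\<close> at the origin and \<open>1\<close> at
  \<open>axis j 1\<close> gives at least linear growth along the axis beyond
  \<open>axis j 1\<close>; \<open>x\<close> dominates its projection to that axis.\<close>

lemma component_le_1:
  assumes x: "x \<in> nonneg_orthant" and le: "\<phi> x \<le> 1"
  shows "x $ j \<le> 1"
proof (rule ccontr)
  assume "\<not> x $ j \<le> 1"
  then have t: "x $ j > 1"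
    by simp
  let ?t = "x $ j"
  have nn: "?t *\<^sub>R axis j 1 \<in> nonneg_orthant"
    using t by (auto simp: nonneg_orthant_def axis_def)
  have "axis j 1 = (1 / ?t) *\<^sub>R (?t *\<^sub>R axis j 1) + (1 - 1 / ?t) *\<^sub>R (0 :: real ^ 'm)"
    using t by simp
  then have "1 \<le> (1 / ?t) * \<phi> (?t *\<^sub>R axis j 1) + (1 - 1 / ?t) * \<phi> 0"
    using Phi_convex[OF nn, of 0 "1 / ?t" "1 - 1 / ?t"] t Phi_axis[of j]
    by (simp add: nonneg_orthant_def)
  then have "?t \<le> \<phi> (?t *\<^sub>R axis j 1)"
    using t by (simp add: Phi_zero field_simps)
  also have "\<dots> \<le> \<phi> x"
    using x by (intro Phi_mono[OF nn]) (auto simp: less_eq_vec_def nonneg_orthant_def axis_def)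
  finally show False
    using le t by simp
qed

section \<open>Geometry of the body\<close>

lemma Phi_body_component: "x \<in> Phi_body \<phi> \<Longrightarrow> \<bar>x $ i\<bar> \<le> 1"
  using component_le_1[of "\<bar>x\<bar>" i] by (simp add: Phi_body_def)

lemma unconditional_Phi_body: "unconditional (Phi_body \<phi>)"
  by (rule unconditionalI) (simp add: Phi_body_def)

lemma Phi_body_Int_orthant:
  "Phi_body \<phi> \<inter> nonneg_orthant = {x. (\<forall>i. x $ i \<in> {0..1}) \<and> \<phi> x \<le> 1}"
  using component_le_1
  by (auto simp: Phi_body_def abs_vec_of_nonneg)
    (auto simp: nonneg_orthant_def abs_vec_of_nonneg)

lemma convex_Phi_body: "convex (Phi_body \<phi>)"
proof (rule convexI)
  fix x y and u v :: real
  assume x: "x \<in> Phi_body \<phi>" and y: "y \<in> Phi_body \<phi>" and uv: "0 \<le> u" "0 \<le> v" "u + v = 1"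
  have "\<bar>u *\<^sub>R x + v *\<^sub>R y\<bar> \<le> u *\<^sub>R \<bar>x\<bar> + v *\<^sub>R \<bar>y\<bar>"
    using uv by (auto simp: less_eq_vec_def abs_mult intro: order_trans[OF abs_triangle_ineq])
  then have "\<phi> \<bar>u *\<^sub>R x + v *\<^sub>R y\<bar> \<le> \<phi> (u *\<^sub>R \<bar>x\<bar> + v *\<^sub>R \<bar>y\<bar>)"
    by (intro Phi_mono) auto
  also have "\<dots> \<le> u * \<phi> \<bar>x\<bar> + v * \<phi> \<bar>y\<bar>"
    using uv by (intro Phi_convex) auto
  also have "\<dots> \<le> 1"
    using x y uv by (intro convex_bound_le) (auto simp: Phi_body_def)
  finally show "u *\<^sub>R x + v *\<^sub>R y \<in> Phi_body \<phi>"
    by (simp add: Phi_body_def)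
qed

text \<open>Convexity excludes an upward jump at \<open>l\<close> along its ray: \<open>l\<close>
  lies between \<open>t *\<^sub>R l\<close> and \<open>2 *\<^sub>R l\<close>, and the weight
  \<open>u\<close> of the latter can be made arbitrarily small.\<close>

lemma Phi_le_1_limit:
  assumes l: "l \<in> nonneg_orthant" and t: "\<And>t. 0 \<le> t \<Longrightarrow> t < 1 \<Longrightarrow> \<phi> (t *\<^sub>R l) \<le> 1"
  shows "\<phi> l \<le> 1"
proof (rule ccontr)
  assume "\<not> \<phi> l \<le> 1"
  define D where "D = \<phi> (2 *\<^sub>R l)"
  define d where "d = \<phi> l - 1"
  \<comment> \<open>The second bound keeps the error \<open>u * (D + 1)\<close> below half the
    excess \<open>d\<close>; the bound \<open>1/4\<close> ensures \<open>0 \<le> t\<close>. The next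
    line solves \<open>(1 - u) * t + 2 * u = 1\<close> for \<open>t\<close>.\<close>
  define u where "u = min (1/4) (d / (2 * (D + 1)))"
  define t where "t = (1 - 2 * u) / (1 - u)"
  have nn: "s *\<^sub>R l \<in> nonneg_orthant" if "0 \<le> s" for s
    using l that by (simp add: nonneg_orthant_def)
  have d: "d > 0"
    using \<open>\<not> \<phi> l \<le> 1\<close> by (simp add: d_def)
  have D: "D \<ge> 0"
    unfolding D_def by (intro Phi_nonneg nn) simp
  have u: "0 < u" "u \<le> 1/4" "u \<le> d / (2 * (D + 1))"
    using d D unfolding u_def by (simp, intro min.cobounded1, intro min.cobounded2)
  then have ts: "0 \<le> t" "t < 1" "(1 - u) * t + 2 * u = 1"
    by (auto simp: t_def field_simps)
  have "l = ((1 - u) * t + u * 2) *\<^sub>R l"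
    using ts(3) by (simp add: mult.commute)
  also have "\<dots> = (1 - u) *\<^sub>R (t *\<^sub>R l) + u *\<^sub>R (2 *\<^sub>R l)"
    by (simp add: scaleR_add_left)
  finally have "\<phi> l \<le> (1 - u) * \<phi> (t *\<^sub>R l) + u * D"
    using Phi_convex[of "t *\<^sub>R l" "2 *\<^sub>R l" "1 - u" u] u ts nn by (simp add: D_def)
  also have "\<dots> \<le> (1 - u) * 1 + u * D"
    using u t[of t] ts by (intro add_mono mult_left_mono) auto
  also have "\<dots> \<le> 1 + u * (D + 1)"
    using u by (simp add: algebra_simps)
  also have "u * (D + 1) \<le> d / 2"
    using u(3) D by (simp add: field_simps)
  finally show False
    using d d_def by linarith
qed

text \<open>For \<open>t < 1\<close> the sequence eventually dominates
  \<open>t *\<^sub>R \<bar>l\<bar>\<close> coordinatewise in absolute value, so monotonicity bounds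
  \<open>\<phi>\<close> there, and \<open>Phi_le_1_limit\<close> lets \<open>t\<close> tend to
  \<open>1\<close>.\<close>

lemma closed_Phi_body: "closed (Phi_body \<phi>)"
  unfolding closed_sequential_limits
proof (intro allI impI, elim conjE)
  fix x and l :: "real ^ 'm"
  assume x: "\<forall>n. x n \<in> Phi_body \<phi>" and lim: "x \<longlonglongrightarrow> l"
  have "\<phi> \<bar>l\<bar> \<le> 1"
  proof (rule Phi_le_1_limit)
    fix t :: real assume t: "0 \<le> t" "t < 1"
    have "eventually (\<lambda>n. t * \<bar>l $ i\<bar> \<le> \<bar>x n $ i\<bar>) sequentially" for i
    proof (cases "l $ i = 0")
      case False
      have "(\<lambda>n. \<bar>x n $ i\<bar>) \<longlonglongrightarrow> \<bar>l $ i\<bar>"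
        using lim by (intro tendsto_intros)
      moreover have "t * \<bar>l $ i\<bar> < \<bar>l $ i\<bar>"
        using t False by simp
      ultimately have "eventually (\<lambda>n. t * \<bar>l $ i\<bar> < \<bar>x n $ i\<bar>) sequentially"
        by (rule order_tendstoD)
      then show ?thesis
        by (rule eventually_mono) simp
    qed simp
    then have "eventually (\<lambda>n. \<forall>i. t * \<bar>l $ i\<bar> \<le> \<bar>x n $ i\<bar>) sequentially"
      by (intro eventually_all_finite)
    then obtain n where n: "\<And>i. t * \<bar>l $ i\<bar> \<le> \<bar>x n $ i\<bar>"
      using eventually_happens trivial_limit_sequentially by blast
    have "\<phi> (t *\<^sub>R \<bar>l\<bar>) \<le> \<phi> \<bar>x n\<bar>"
      using n t by (intro Phi_mono) (auto simp: nonneg_orthant_def less_eq_vec_def)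
    also have "\<dots> \<le> 1"
      using x by (simp add: Phi_body_def)
    finally show "\<phi> (t *\<^sub>R \<bar>l\<bar>) \<le> 1" .
  qed simp
  then show "l \<in> Phi_body \<phi>"
    by (simp add: Phi_body_def)
qed

lemma compact_Phi_body: "compact (Phi_body \<phi>)"
proof -
  have "norm x \<le> (\<Sum>i\<in>(UNIV :: 'm set). 1)" if "x \<in> Phi_body \<phi>" for x
    using norm_le_l1_cart[of x] Phi_body_component[OF that]
    by (meson order_trans sum_mono)
  then have "bounded (Phi_body \<phi>)"
    unfolding bounded_iff by blast
  with closed_Phi_body show ?thesis
    by (simp add: compact_eq_bounded_closed)
qed

text \<open>By Jensen's inequality \<open>\<phi>\<close> is at most \<open>1\<close> at the mean
  \<open>?s\<close> of the unit vectors, and \<open>?s\<close> dominates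
  \<open>\<bar>x\<bar>\<close> for every \<open>x\<close> in the ball of radius
  \<open>?r\<close>.\<close>

lemma zero_interior_Phi_body: "0 \<in> interior (Phi_body \<phi>)"
proof -
  let ?r = "1 / real CARD('m)"
  have r: "?r > 0"
    by simp
  have "x \<in> Phi_body \<phi>" if "x \<in> cball 0 ?r" for x
  proof -
    let ?s = "\<Sum>j\<in>(UNIV :: 'm set). ?r *\<^sub>R axis j (1 :: real)"
    have s: "?s = (\<chi> i. ?r)"
      by (simp add: vec_eq_iff axis_def if_distrib cong: if_cong)
    have "\<bar>x $ i\<bar> \<le> ?r" for i
      using that component_le_norm_cart[of x i] by simp
    then have "\<phi> \<bar>x\<bar> \<le> \<phi> ?s"
      unfolding s by (intro Phi_mono) (auto simp: less_eq_vec_def)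
    also have "\<dots> \<le> (\<Sum>j\<in>(UNIV :: 'm set). ?r * \<phi> (axis j 1))"
      using Phi
      by (intro convex_on_sum[of _ nonneg_orthant])
        (auto simp: Phi_def nonneg_orthant_def axis_def)
    also have "\<dots> = 1"
      by (simp add: Phi_axis)
    finally show ?thesis
      by (simp add: Phi_body_def)
  qed
  with r show ?thesis
    unfolding mem_interior_cball by blast
qed

lemma axis_frontier_Phi_body: "axis j 1 \<in> frontier (Phi_body \<phi>)"
proof -
  let ?e = "axis j (1 :: real)"
  have "\<bar>?e\<bar> = ?e"
    by (auto simp: vec_eq_iff axis_def)
  then have "?e \<in> Phi_body \<phi>"
    by (simp add: Phi_body_def Phi_axis)
  moreover have "?e \<notin> interior (Phi_body \<phi>)"
  proof
    assume "?e \<in> interior (Phi_body \<phi>)"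
    then obtain r where r: "r > 0" "cball ?e r \<subseteq> Phi_body \<phi>"
      by (auto simp: mem_interior_cball)
    have "?e + r *\<^sub>R ?e \<in> cball ?e r"
      using r by (simp add: dist_norm)
    then have "\<bar>(?e + r *\<^sub>R ?e) $ j\<bar> \<le> 1"
      using r(2) Phi_body_component by blast
    with r(1) show False
      by (simp add: axis_def)
  qed
  ultimately show ?thesis
    using closure_subset by (auto simp: frontier_def)
qed

section \<open>Orlicz sums as \<open>M\<close>-sums\<close>

lemma orlicz_support_eq:
  assumes K: "\<And>j. K j \<in> compact_convex_o"
  shows "orlicz_support \<phi> K x = support_fun (polar_set (Phi_body \<phi>)) (\<chi> j. support_fun (K j) x)"
proof -
  \<comment> \<open>As each \<open>K j\<close> contains the origin, the support values are
    nonnegative and the absolute value disappears; the Orlicz infimum is then the gauge of the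
    body.\<close>
  have "\<bar>(1 / l) *\<^sub>R (\<chi> j. support_fun (K j) x)\<bar> = (\<chi> j. support_fun (K j) x / l)" if "l > 0" for l
    using that support_fun_nonneg[OF K, of _ x] by (simp add: vec_eq_iff)
  then have "{l. l > 0 \<and> \<phi> (\<chi> j. support_fun (K j) x / l) \<le> 1} =
      {l. l > 0 \<and> (1 / l) *\<^sub>R (\<chi> j. support_fun (K j) x) \<in> Phi_body \<phi>}"
    by (auto simp: Phi_body_def)
  then show ?thesis
    unfolding orlicz_support_def
    by (simp add: support_fun_polar_set closed_Phi_body convex_Phi_body zero_interior_Phi_body)
qed

lemma orlicz_sum_compact_convex_o:
  fixes K :: "'m \<Rightarrow> ('a::euclidean_space) set"
  assumes K: "\<And>j. K j \<in> compact_convex_o"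
  shows "orlicz_sum \<phi> K = M_sum (polar_set (Phi_body \<phi>) \<inter> nonneg_orthant) K" (is "?L = M_sum ?M K")
    and "orlicz_sum \<phi> K \<in> compact_convex_o"
    and "support_fun (orlicz_sum \<phi> K) x =
      support_fun (polar_set (Phi_body \<phi>)) (\<chi> j. support_fun (K j) x)"
proof -
  let ?P = "polar_set (Phi_body \<phi>)"
  have Ko: "compact (K j)" "convex (K j)" "0 \<in> K j" for j
    using K[of j] by (auto simp: compact_convex_o_def)
  have orth: "closed (nonneg_orthant :: (real ^ 'm) set)" "convex (nonneg_orthant :: (real ^ 'm) set)"
    using closed_vector_box[of "\<lambda>_. {0 :: real..}"]
    by (auto simp: nonneg_orthant_def convex_def)
  have P: "compact ?P" "unconditional ?P" "?P \<noteq> {}"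
    using zero_mem_polar_set
    by (auto intro: compact_polar_set zero_interior_Phi_body unconditional_polar_set
        unconditional_Phi_body)
  have M: "compact ?M" "convex ?M" "0 \<in> ?M"
    using P orth zero_mem_polar_set convex_polar_set
    by (auto intro: compact_Int_closed convex_Int simp: nonneg_orthant_def)
  have "(\<Sum>j\<in>UNIV. ((0 :: real ^ 'm) $ j) *\<^sub>R (0 :: 'a)) \<in> M_sum ?M K"
    using M(3) Ko(3) by (rule M_sumI)
  then have sum0: "0 \<in> M_sum ?M K"
    by simp
  have sum: "compact (M_sum ?M K)" "convex (M_sum ?M K)"
    using M Ko by (auto intro: compact_M_sum convex_M_sum)
  have "support_fun (M_sum ?M K) x = support_fun ?M (\<chi> j. support_fun (K j) x)" for x
    using M Ko by (intro support_fun_M_sum) auto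
  \<comment> \<open>The vector of support values lies in the orthant, so cutting the unconditional
    \<open>?P\<close> down to \<open>?M\<close> loses nothing.\<close>
  moreover have "support_fun ?M (\<chi> j. support_fun (K j) x) = support_fun ?P (\<chi> j. support_fun (K j) x)"
    for x
    using P support_fun_nonneg[OF K]
    by (intro support_fun_unconditional) (auto simp: nonneg_orthant_def)
  ultimately have supp: "support_fun (M_sum ?M K) x = support_fun ?P (\<chi> j. support_fun (K j) x)" for x
    by simp
  show eq: "?L = M_sum ?M K"
    using sum sum0 supp orlicz_support_eq[OF K] by (intro orlicz_sum_eqI) auto
  show "orlicz_sum \<phi> K \<in> compact_convex_o"
    unfolding eq using sum sum0 by (simp add: compact_convex_o_def)
  show "support_fun (orlicz_sum \<phi> K) x = support_fun ?P (\<chi> j. support_fun (K j) x)"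
    unfolding eq by (rule supp)
qed

lemma orlicz_sum_compact_convex_s:
  assumes K: "\<And>j. K j \<in> compact_convex_s"
  shows "orlicz_sum \<phi> K = M_sum (polar_set (Phi_body \<phi>)) K"
    and "orlicz_sum \<phi> K \<in> compact_convex_s"
proof -
  have Ko: "K j \<in> compact_convex_o" for j
    using K compact_convex_s_subset_o by blast
  show eq: "orlicz_sum \<phi> K = M_sum (polar_set (Phi_body \<phi>)) K"
    using orlicz_sum_compact_convex_o(1)[of K] Ko K
      M_sum_unconditional[OF unconditional_polar_set[OF unconditional_Phi_body], of K]
    by simp
  have "K j = uminus ` K j" for j
    using K[of j] by (simp add: compact_convex_s_def)
  then have "orlicz_sum \<phi> K = uminus ` orlicz_sum \<phi> K"
    unfolding eq by (rule M_sum_symmetric)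
  with orlicz_sum_compact_convex_o(2)[of K] Ko show "orlicz_sum \<phi> K \<in> compact_convex_s"
    by (auto simp: compact_convex_s_def compact_convex_o_def)
qed

end

theorem theorem5p3:
  fixes \<phi> :: "real ^ 'm \<Rightarrow> real"
  assumes "CARD('m) \<ge> 2" and "CARD('n::finite) \<ge> 2"
    and "\<phi> \<in> Phi"
  shows "\<exists>J :: (real ^ 'm) set.
      unconditional J \<and> convex_body J \<and>
      J \<subseteq> {x. \<forall>i. x $ i \<in> {-1..1}} \<and>
      (\<forall>j. axis j 1 \<in> frontier J) \<and>
      J \<inter> nonneg_orthant = {x. (\<forall>i. x $ i \<in> {0..1}) \<and> \<phi> x \<le> 1} \<and>
      (\<forall>J'. unconditional J' \<and>
            J' \<inter> nonneg_orthant = {x. (\<forall>i. x $ i \<in> {0..1}) \<and> \<phi> x \<le> 1} \<longrightarrow> J' = J) \<and>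
      (\<forall>K :: 'm \<Rightarrow> (real ^ 'n) set. (\<forall>j. K j \<in> compact_convex_s) \<longrightarrow>
            orlicz_sum \<phi> K \<in> compact_convex_s \<and>
            orlicz_sum \<phi> K = M_sum (polar_set J) K) \<and>
      (\<forall>K :: 'm \<Rightarrow> (real ^ 'n) set. (\<forall>j. K j \<in> compact_convex_o) \<longrightarrow>
            orlicz_sum \<phi> K \<in> compact_convex_o \<and>
            orlicz_sum \<phi> K = M_sum (polar_set J \<inter> nonneg_orthant) K \<and>
            (\<forall>x. support_fun (orlicz_sum \<phi> K) x =
                 support_fun (polar_set J) (\<chi> j. support_fun (K j) x)))"
proof (intro exI[of _ "Phi_body \<phi>"] conjI allI impI)
  note [simp] = \<open>\<phi> \<in> Phi\<close>
  show "unconditional (Phi_body \<phi>)"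
    by (simp add: unconditional_Phi_body)
  show "convex_body (Phi_body \<phi>)"
    using zero_interior_Phi_body[OF assms(3)]
    by (auto simp: convex_body_def compact_Phi_body convex_Phi_body)
  show "Phi_body \<phi> \<subseteq> {x. \<forall>i. x $ i \<in> {-1..1}}"
    using Phi_body_component[OF assms(3)] by (force simp: abs_le_iff)
  show "axis j 1 \<in> frontier (Phi_body \<phi>)" for j
    by (simp add: axis_frontier_Phi_body)
  show "Phi_body \<phi> \<inter> nonneg_orthant = {x. (\<forall>i. x $ i \<in> {0..1}) \<and> \<phi> x \<le> 1}"
    by (rule Phi_body_Int_orthant) simp
  \<comment> \<open>Uniqueness holds among all unconditional sets, with no convexity or compactness
    asked of \<open>J'\<close>.\<close>
  show "J' = Phi_body \<phi>" if "unconditional J' \<and>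
      J' \<inter> nonneg_orthant = {x. (\<forall>i. x $ i \<in> {0..1}) \<and> \<phi> x \<le> 1}" for J'
    using that Phi_body_Int_orthant[OF assms(3)] unconditional_Phi_body[OF assms(3)]
    by (simp add: unconditional_eqI)
next
  fix K :: "'m \<Rightarrow> (real ^ 'n) set" assume "\<forall>j. K j \<in> compact_convex_s"
  then have K: "\<And>j. K j \<in> compact_convex_s"
    by blast
  show "orlicz_sum \<phi> K \<in> compact_convex_s"
    and "orlicz_sum \<phi> K = M_sum (polar_set (Phi_body \<phi>)) K"
    using orlicz_sum_compact_convex_s[of \<phi> K, OF assms(3) K] by simp_all
next
  fix K :: "'m \<Rightarrow> (real ^ 'n) set" assume "\<forall>j. K j \<in> compact_convex_o"
  then have K: "\<And>j. K j \<in> compact_convex_o"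
    by blast
  show "orlicz_sum \<phi> K \<in> compact_convex_o"
    and "orlicz_sum \<phi> K = M_sum (polar_set (Phi_body \<phi>) \<inter> nonneg_orthant) K"
    and "support_fun (orlicz_sum \<phi> K) x =
      support_fun (polar_set (Phi_body \<phi>)) (\<chi> j. support_fun (K j) x)" for x
    using orlicz_sum_compact_convex_o[of \<phi> K, OF assms(3) K] by simp_all
qed

end
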